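(* Let $f:\mathbb{R}^n\to\mathbb{R}$ be a polynomial that is affine in each block $x^{(j)}$, $j\in[m]$ (the other blocks being fixed), with block partial gradients $\Phi^{(j)}$. Let $T>0$ and let $\bar y=\bar y(T)$ be an equilibrium point of the ODE system $$\frac{\mathrm{d}y^{(j)}_i}{\mathrm{d}t}=-y^{(j)}_i+\sigma_i\left(-\Phi^{(j)}(y);1/T\right),\qquad j\in[m],\ i\in[d_j],$$ that is, $\bar y^{(j)}=\sigma(-\Phi^{(j)}(\bar y);1/T)$ for all $j\in[m]$. Assume that there exists $\hat y\in\bar{\mathcal X}$ whose distance to $\bar y$, $\varepsilon:=\|\hat y-\bar y\|_\infty>0$, satisfies $$\hat d\,\varepsilon<\frac12,\qquad \frac{\varepsilon}{\ln\left(1/(\hat d\varepsilon)-1\right)}<\frac{T}{2L},\qquad T\ln\frac{1+\hat d\varepsilon}{1-\hat d\varepsilon}+2L\varepsilon<\mathsf g .$$ Then $$\hat y^{(j)}=\hat\sigma\left(-\Phi^{(j)}(\hat y)\right)\qquad\text{for all } j\in[m],$$ and thus $\hat y$ is a local optimum of $f$ in $\bar{\mathcal X}$.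
   Context: Write $[k]=\{1,\dots,k\}$. The index set $[n]$ is partitioned into $m$ disjoint subsets $I_1,\dots,I_m$ with $d_j:=|I_j|\ge 2$. A vector $x\in\mathbb{R}^n$ is correspondingly divided into blocks $x=(x^{(1)},\dots,x^{(m)})$ with $x^{(j)}\in\mathbb{R}^{d_j}$, whose entries are $x^{(j)}_i$, $i\in[d_j]$. Let $x^{(\bar j)}$ denote the $(n-d_j)$-dimensional vector obtained from $x$ by deleting the block $x^{(j)}$, and $(x^{(\bar j)},\xi)$ the vector obtained from $x$ by replacing $x^{(j)}$ with $\xi\in\mathbb{R}^{d_j}$. Put $\hat d=\max\{d_1,\dots,d_m\}$. Define $\Phi^{(j)}_i=\partial f/\partial x^{(j)}_i$ and $\Phi^{(j)}=(\Phi^{(j)}_i)_{i\in[d_j]}$. Since $f$ is affine in each block, $\Phi^{(j)}$ does not depend on $x^{(j)}$, and $f(x)=x^{(j)}\cdot\Phi^{(j)}(x)+f((x^{(\bar j)},0))$ for every $j$. Softmax: for $z\in\mathbb{R}^d$ and $\beta>0$, $\sigma(z;\beta)=(\sigma_i(z;\beta))_{i\in[d]}$ with $\sigma_i(z;\beta)=\exp(\beta z_i)/\sum_{k=1}^d\exp(\beta z_k)$. Hard max: for $z\in\mathbb{R}^d$, $\hat\sigma(z)=(\hat\sigma_i(z))_{i\in[d]}$ is defined by $\hat\sigma_i(z)=1/r$ if $z_i=\max\{z_1,\dots,z_d\}$ and $\hat\sigma_i(z)=0$ otherwise, where $r$ is the number of indices $i$ with $z_i=\max\{z_1,\dots,z_d\}$.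 For $d\ge1$ let $\bar B_d=\{\frac{1}{|A|}\chi^A : \varnothing\ne A\subseteq[d]\}\subset\mathbb{R}^d$, where $\chi^A\in\mathbb{R}^d$ is the indicator vector of $A$, and let $\bar{\mathcal X}=\bar B_{d_1}\times\cdots\times\bar B_{d_m}$. $L$ denotes the maximum over all $j\in[m]$, $i\in[d_j]$ of the Lipschitz constant of $\Phi^{(j)}_i$ on $[0,1]^n$ in the sup norm; thus $|\Phi^{(j)}_i(x)-\Phi^{(j)}_i(x')|\le L\|x-x'\|_\infty$ for all $j\in[m]$, $i\in[d_j]$, $x,x'\in[0,1]^n$. If $L=0$, $T/(2L)$ is read as $+\infty$. The minimal gap of $\Phi$ is $$\mathsf g=\min\left\{\left|\Phi^{(j)}_{i'}(x)-\Phi^{(j)}_i(x)\right| : \Phi^{(j)}_{i'}(x)\ne\Phi^{(j)}_i(x),\ x\in\bar{\mathcal X},\ j\in[m],\ i',i\in[d_j]\right\}$$ (read as $+\infty$ if the set is empty). Local optimality: $x\in\bar{\mathcal X}$ is a local optimum of $f$ in $\bar{\mathcal X}$ if $f(x')\ge f(x)$ for every $x'\in\bar{\mathcal X}$ for which there exists $j_0\in[m]$ with $(x')^{(\bar{j_0})}=x^{(\bar{j_0})}$. *)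

theory Defs
  imports "HOL-Analysis.Analysis"
begin

text \<open>
  The coordinates of \<open>\<real>\<^sup>n\<close> are indexed by a finite type \<open>'n\<close>, the blocks by a finite type \<open>'m\<close>.
  Block \<open>j\<close> is the coordinate set \<open>I j\<close>, and the entries of the block \<open>x\<^sup>(\<^sup>j\<^sup>)\<close> are the \<open>x $ i\<close> with
  \<open>i \<in> I j\<close>: the position of an entry within its block is named by its coordinate instead of by a
  number in \<open>{1..card (I j)}\<close>.
\<close>

definition block_partition :: "('m::finite \<Rightarrow> 'n::finite set) \<Rightarrow> bool" where
  "block_partition I \<longleftrightarrow>
     disjoint_family I \<and> (\<Union>j. I j) = UNIV \<and> (\<forall>j. card (I j) \<ge> 2)"

definition max_block_size :: "('m::finite \<Rightarrow> 'n::finite set) \<Rightarrow> nat" where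
  "max_block_size I = Max (range (\<lambda>j. card (I j)))"

text \<open>The vector \<open>(x\<^sup>(\<^sup>-\<^sup>j\<^sup>), \<xi>)\<close>; only the entries of \<open>\<xi>\<close> inside the block \<open>A\<close> are used.\<close>

definition replace_block :: "'n::finite set \<Rightarrow> real ^ 'n \<Rightarrow> real ^ 'n \<Rightarrow> real ^ 'n" where
  "replace_block A x \<xi> = (\<chi> i. if i \<in> A then \<xi> $ i else x $ i)"

definition affine_in_block :: "'n::finite set \<Rightarrow> (real ^ 'n \<Rightarrow> real) \<Rightarrow> bool" where
  "affine_in_block A f \<longleftrightarrow>
     (\<forall>x. \<exists>a c. \<forall>\<xi>. f (replace_block A x \<xi>) = (\<Sum>i\<in>A. a i * \<xi> $ i) + c)"

definition partial_derivative :: "(real ^ 'n \<Rightarrow> real) \<Rightarrow> 'n::finite \<Rightarrow> real ^ 'n \<Rightarrow> real" where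
  "partial_derivative f i x = deriv (\<lambda>t. f (x + t *\<^sub>R axis i 1)) 0"

definition softmax :: "'i set \<Rightarrow> ('i \<Rightarrow> real) \<Rightarrow> real \<Rightarrow> 'i \<Rightarrow> real" where
  "softmax A z \<beta> i = exp (\<beta> * z i) / (\<Sum>k\<in>A. exp (\<beta> * z k))"

definition hardmax :: "'i set \<Rightarrow> ('i \<Rightarrow> real) \<Rightarrow> 'i \<Rightarrow> real" where
  "hardmax A z i =
     (if z i = Max (z ` A) then 1 / real (card {k \<in> A. z k = Max (z ` A)}) else 0)"

definition uniform_points :: "('m::finite \<Rightarrow> 'n::finite set) \<Rightarrow> (real ^ 'n) set" where
  "uniform_points I =
     {x. \<forall>j. \<exists>A. A \<noteq> {} \<and> A \<subseteq> I j \<and> (\<forall>i\<in>I j. x $ i = 1 / real (card A) * indicator A i)}"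

text \<open>The Lipschitz constant with respect to the sup norm, i.e. the least admissible bound.
  The library's \<open>lipschitz_on\<close> refers to the Euclidean distance on \<open>real ^ 'n\<close> instead.\<close>

definition sup_lipschitz_constant :: "(real ^ 'n::finite) set \<Rightarrow> (real ^ 'n \<Rightarrow> real) \<Rightarrow> real" where
  "sup_lipschitz_constant S g =
     Inf {C. 0 \<le> C \<and> (\<forall>x\<in>S. \<forall>x'\<in>S. \<bar>g x - g x'\<bar> \<le> C * infnorm (x - x'))}"

definition unit_cube :: "(real ^ 'n::finite) set" where
  "unit_cube = {x. \<forall>i. 0 \<le> x $ i \<and> x $ i \<le> 1}"

definition gradient_lipschitz :: "(real ^ 'n::finite \<Rightarrow> real) \<Rightarrow> real" where
  "gradient_lipschitz f =
     Max (range (\<lambda>i. sup_lipschitz_constant unit_cube (partial_derivative f i)))"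

text \<open>\<open>uniform_points I\<close> is finite when \<open>I\<close> is a partition, so the minimum below is over a finite set.\<close>

definition gap_values :: "('m::finite \<Rightarrow> 'n::finite set) \<Rightarrow> (real ^ 'n \<Rightarrow> real) \<Rightarrow> real set" where
  "gap_values I f =
     {\<bar>partial_derivative f i' x - partial_derivative f i x\<bar> | x j i' i.
        x \<in> uniform_points I \<and> i' \<in> I j \<and> i \<in> I j \<and>
        partial_derivative f i' x \<noteq> partial_derivative f i x}"

definition minimal_gap :: "('m::finite \<Rightarrow> 'n::finite set) \<Rightarrow> (real ^ 'n \<Rightarrow> real) \<Rightarrow> ereal" where
  "minimal_gap I f = (if gap_values I f = {} then \<infinity> else ereal (Min (gap_values I f)))"

definition local_optimum ::
  "('m::finite \<Rightarrow> 'n::finite set) \<Rightarrow> (real ^ 'n \<Rightarrow> real) \<Rightarrow> real ^ 'n \<Rightarrow> bool" where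
  "local_optimum I f x \<longleftrightarrow>
     x \<in> uniform_points I \<and>
     (\<forall>x' \<in> uniform_points I. (\<exists>j. \<forall>i. i \<notin> I j \<longrightarrow> x' $ i = x $ i) \<longrightarrow> f x' \<ge> f x)"

text \<open>Right-hand side, for the coordinate \<open>i\<close> of block \<open>j\<close>, of the system
  \<open>dy\<^sub>i/dt = - y\<^sub>i + \<sigma>\<^sub>i (- \<Phi>\<^sup>(\<^sup>j\<^sup>)(y); 1/T)\<close>.\<close>

definition softmax_field ::
  "('m::finite \<Rightarrow> 'n::finite set) \<Rightarrow> (real ^ 'n \<Rightarrow> real) \<Rightarrow> real \<Rightarrow> real ^ 'n \<Rightarrow> 'm \<Rightarrow> 'n \<Rightarrow> real" where
  "softmax_field I f T y j i =
     - y $ i + softmax (I j) (\<lambda>k. - partial_derivative f k y) (1 / T) i"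

definition equilibrium ::
  "('m::finite \<Rightarrow> 'n::finite set) \<Rightarrow> (real ^ 'n \<Rightarrow> real) \<Rightarrow> real \<Rightarrow> real ^ 'n \<Rightarrow> bool" where
  "equilibrium I f T y \<longleftrightarrow> (\<forall>j. \<forall>i\<in>I j. softmax_field I f T y j i = 0)"

end

theory Submission
  imports Defs
begin

text \<open>
  Write \<open>\<Phi>\<close> for the gradient and \<open>d\<close> for the largest block size. In a softmax vector the logarithm
  of the ratio of two entries is a scaled difference of the corresponding inputs, so at an
  equilibrium \<open>T * ln (ybar $ i / ybar $ k) = \<Phi> k ybar - \<Phi> i ybar\<close> whenever \<open>i\<close> and \<open>k\<close> lie in one block
  (lemma \<open>equilibrium_gradient_difference\<close>). Proximity of \<open>ybar\<close> to a point \<open>yhat\<close> that is uniform on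
  a set \<open>A\<close> in that block thus controls differences of \<open>\<Phi>\<close> at \<open>ybar\<close>, and hence at \<open>yhat\<close>, up to
  an error \<open>2 * L * \<epsilon>\<close>.

  Inside \<open>A\<close>, the ratio is at most \<open>(1 + d * \<epsilon>) / (1 - d * \<epsilon>)\<close>. Two gradient entries
  at \<open>yhat\<close> therefore differ by less than the minimal gap, which forces them to be equal. Between
  an index in \<open>A\<close> and one outside, the ratio is at least \<open>1 / (d * \<epsilon>) - 1\<close>, and the bound on
  \<open>\<epsilon> / ln (1 / (d * \<epsilon>) - 1)\<close> says precisely that the error \<open>2 * L * \<epsilon>\<close> cannot
  reverse the resulting strict inequality. So \<open>A\<close> is exactly the set of minimisers of \<open>\<Phi> yhat\<close> in
  the block, that is, \<open>yhat\<close> is the hard max of \<open>- \<Phi> yhat\<close> there.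

  Local optimality follows because \<open>f\<close> is affine in a block: the change of \<open>f\<close> is the change
  of a \<open>\<Phi> yhat\<close>-weighted average, and the hard max puts all its weight on the smallest entries
  (lemma \<open>local_optimum_if_hardmax\<close>).

  The argument uses the Lipschitz constant and the gap as actual bounds, which rests on the partial
  derivatives of a polynomial being polynomials, hence Lipschitz on the cube, and on there being
  only finitely many uniform points.
\<close>

section \<open>Lipschitz bounds for the gradient of a polynomial\<close>

text \<open>Carrying the derivative along the line as a relation, rather than through \<open>deriv\<close>, makes the
  sum and product rules applicable in the induction.\<close>

lemma real_polynomial_function_has_partial_derivative:
  fixes f :: "real ^ 'n::finite \<Rightarrow> real"
  assumes "real_polynomial_function f"
  shows "\<exists>g. real_polynomial_function g \<and>
           (\<forall>x. ((\<lambda>t. f (x + t *\<^sub>R axis i 1)) has_real_derivative g x) (at 0))"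
  using assms
proof induction
  case (linear f)
  then have eq: "f (x + t *\<^sub>R axis i 1) = f x + t * f (axis i 1)" for x t
    by (simp add: bounded_linear.linear linear_add linear_scale)
  have "((\<lambda>t. f (x + t *\<^sub>R axis i 1)) has_real_derivative f (axis i 1)) (at 0)" for x
    unfolding eq by (auto intro!: derivative_eq_intros)
  then show ?case
    by (intro exI[of _ "\<lambda>_. f (axis i 1)"]) (auto intro: real_polynomial_function.intros)
next
  case (const c)
  show ?case
    by (intro exI[of _ "\<lambda>_. 0"]) (auto intro: real_polynomial_function.intros)
next
  case (add f1 f2)
  then obtain g1 g2 where "real_polynomial_function g1" "real_polynomial_function g2"
    and "\<And>x. ((\<lambda>t. f1 (x + t *\<^sub>R axis i 1)) has_real_derivative g1 x) (at 0)"
    and "\<And>x. ((\<lambda>t. f2 (x + t *\<^sub>R axis i 1)) has_real_derivative g2 x) (at 0)"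
    by blast
  then show ?case
    by (intro exI[of _ "\<lambda>x. g1 x + g2 x"])
       (auto intro!: derivative_intros real_polynomial_function.intros(3))
next
  case (mult f1 f2)
  then obtain g1 g2 where g: "real_polynomial_function g1" "real_polynomial_function g2"
    and d1: "\<And>x. ((\<lambda>t. f1 (x + t *\<^sub>R axis i 1)) has_real_derivative g1 x) (at 0)"
    and d2: "\<And>x. ((\<lambda>t. f2 (x + t *\<^sub>R axis i 1)) has_real_derivative g2 x) (at 0)"
    by blast
  have "((\<lambda>t. f1 (x + t *\<^sub>R axis i 1) * f2 (x + t *\<^sub>R axis i 1))
          has_real_derivative g1 x * f2 x + g2 x * f1 x) (at 0)" for x
    using DERIV_mult[OF d1[of x] d2[of x]] by simp
  moreover have "real_polynomial_function (\<lambda>x. g1 x * f2 x + g2 x * f1 x)"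
    using g mult.hyps by (intro real_polynomial_function.intros(3,4))
  ultimately show ?case
    by (intro exI[of _ "\<lambda>x. g1 x * f2 x + g2 x * f1 x"]) simp
qed

lemma real_polynomial_function_partial_derivative:
  assumes "real_polynomial_function f"
  shows "real_polynomial_function (partial_derivative f i)"
proof -
  obtain g where "real_polynomial_function g"
    and "\<And>x. ((\<lambda>t. f (x + t *\<^sub>R axis i 1)) has_real_derivative g x) (at 0)"
    using real_polynomial_function_has_partial_derivative[OF assms] by blast
  moreover from this(2) have "partial_derivative f i = g"
    unfolding partial_derivative_def by (intro ext DERIV_imp_deriv)
  ultimately show ?thesis by simp
qed

lemma infnorm_le_1_unit_cube:
  fixes x :: "real ^ 'n::finite"
  assumes "x \<in> unit_cube"
  shows "infnorm x \<le> 1"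
  unfolding infnorm_cart
proof (rule cSup_least)
  show "y \<le> 1" if "y \<in> {\<bar>x $ i\<bar> |i. i \<in> UNIV}" for y
    using that assms by (auto simp: unit_cube_def)
qed blast

text \<open>The bound on the values is carried along because the product rule for differences needs it.\<close>

lemma real_polynomial_function_lipschitz_unit_cube:
  fixes g :: "real ^ 'n::finite \<Rightarrow> real"
  assumes "real_polynomial_function g"
  shows "\<exists>B C. 0 \<le> B \<and> 0 \<le> C \<and> (\<forall>x\<in>unit_cube. \<bar>g x\<bar> \<le> B) \<and>
           (\<forall>x\<in>unit_cube. \<forall>x'\<in>unit_cube. \<bar>g x - g x'\<bar> \<le> C * infnorm (x - x'))"
  using assms
proof induction
  case (linear g)
  then obtain K where K: "K \<ge> 0" "\<And>x. norm (g x) \<le> norm x * K"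
    using bounded_linear.nonneg_bounded by blast
  define C where "C = K * sqrt DIM(real ^ 'n)"
  have C: "\<bar>g x\<bar> \<le> C * infnorm x" for x
  proof -
    have "\<bar>g x\<bar> \<le> K * norm x" using K(2)[of x] by (simp add: mult.commute)
    also have "\<dots> \<le> K * (sqrt DIM(real ^ 'n) * infnorm x)"
      by (intro mult_left_mono norm_le_infnorm K(1))
    finally show ?thesis by (simp add: C_def mult.assoc)
  qed
  have C0: "C \<ge> 0" using K(1) by (simp add: C_def)
  have "\<bar>g x\<bar> \<le> C" if "x \<in> unit_cube" for x
    using C[of x] mult_left_mono[OF infnorm_le_1_unit_cube[OF that] C0] by simp
  moreover have "\<bar>g x - g x'\<bar> \<le> C * infnorm (x - x')" for x x'
    using C[of "x - x'"] linear by (simp add: bounded_linear.linear linear_diff)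
  ultimately show ?case using C0 by blast
next
  case (const c)
  show ?case by (intro exI[of _ "\<bar>c\<bar>"] exI[of _ 0]) auto
next
  case (add f1 f2)
  then obtain B1 C1 B2 C2 where b: "0 \<le> B1" "0 \<le> C1" "0 \<le> B2" "0 \<le> C2"
    "\<forall>x\<in>unit_cube. \<bar>f1 x\<bar> \<le> B1" "\<forall>x\<in>unit_cube. \<bar>f2 x\<bar> \<le> B2"
    "\<forall>x\<in>unit_cube. \<forall>x'\<in>unit_cube. \<bar>f1 x - f1 x'\<bar> \<le> C1 * infnorm (x - x')"
    "\<forall>x\<in>unit_cube. \<forall>x'\<in>unit_cube. \<bar>f2 x - f2 x'\<bar> \<le> C2 * infnorm (x - x')"
    by blast
  have "\<bar>(f1 x + f2 x) - (f1 x' + f2 x')\<bar> \<le> (C1 + C2) * infnorm (x - x')"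
    if "x \<in> unit_cube" "x' \<in> unit_cube" for x x'
  proof -
    have "\<bar>f1 x - f1 x'\<bar> \<le> C1 * infnorm (x - x')" "\<bar>f2 x - f2 x'\<bar> \<le> C2 * infnorm (x - x')"
      using b(7,8) that by auto
    then show ?thesis unfolding distrib_right by linarith
  qed
  moreover have "\<bar>f1 x + f2 x\<bar> \<le> B1 + B2" if "x \<in> unit_cube" for x
    using b(5,6) that by (meson abs_triangle_ineq add_mono order_trans)
  ultimately show ?case
    using b(1-4) by (intro exI[of _ "B1 + B2"] exI[of _ "C1 + C2"]) auto
next
  case (mult f1 f2)
  then obtain B1 C1 B2 C2 where b: "0 \<le> B1" "0 \<le> C1" "0 \<le> B2" "0 \<le> C2"
    "\<forall>x\<in>unit_cube. \<bar>f1 x\<bar> \<le> B1" "\<forall>x\<in>unit_cube. \<bar>f2 x\<bar> \<le> B2"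
    "\<forall>x\<in>unit_cube. \<forall>x'\<in>unit_cube. \<bar>f1 x - f1 x'\<bar> \<le> C1 * infnorm (x - x')"
    "\<forall>x\<in>unit_cube. \<forall>x'\<in>unit_cube. \<bar>f2 x - f2 x'\<bar> \<le> C2 * infnorm (x - x')"
    by blast
  have "\<bar>f1 x * f2 x - f1 x' * f2 x'\<bar> \<le> (B1 * C2 + C1 * B2) * infnorm (x - x')"
    if x: "x \<in> unit_cube" "x' \<in> unit_cube" for x x'
  proof -
    have "f1 x * f2 x - f1 x' * f2 x' = f1 x * (f2 x - f2 x') + (f1 x - f1 x') * f2 x'"
      by (simp add: algebra_simps)
    then have "\<bar>f1 x * f2 x - f1 x' * f2 x'\<bar>
        \<le> \<bar>f1 x\<bar> * \<bar>f2 x - f2 x'\<bar> + \<bar>f1 x - f1 x'\<bar> * \<bar>f2 x'\<bar>"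
      by (metis abs_mult abs_triangle_ineq)
    also have "\<dots> \<le> B1 * (C2 * infnorm (x - x')) + (C1 * infnorm (x - x')) * B2"
      using b x by (intro add_mono mult_mono) (auto simp: infnorm_pos_le)
    finally show ?thesis by (simp add: algebra_simps)
  qed
  moreover have "\<bar>f1 x * f2 x\<bar> \<le> B1 * B2" if "x \<in> unit_cube" for x
    using b that by (auto simp: abs_mult intro!: mult_mono)
  ultimately show ?case
    using b(1-4) by (intro exI[of _ "B1 * B2"] exI[of _ "B1 * C2 + C1 * B2"]) auto
qed

text \<open>Existence of some bound \<open>C\<close> matters: the infimum of an empty set of reals carries no information.\<close>

lemma sup_lipschitz_constant_bound:
  fixes g :: "real ^ 'n::finite \<Rightarrow> real"
  assumes "0 \<le> C" "\<forall>x\<in>S. \<forall>x'\<in>S. \<bar>g x - g x'\<bar> \<le> C * infnorm (x - x')"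
  shows "0 \<le> sup_lipschitz_constant S g"
    and "x \<in> S \<Longrightarrow> x' \<in> S \<Longrightarrow> \<bar>g x - g x'\<bar> \<le> sup_lipschitz_constant S g * infnorm (x - x')"
proof -
  let ?P = "{C. 0 \<le> C \<and> (\<forall>x\<in>S. \<forall>x'\<in>S. \<bar>g x - g x'\<bar> \<le> C * infnorm (x - x'))}"
  have ne: "?P \<noteq> {}" using assms by auto
  show "0 \<le> sup_lipschitz_constant S g"
    unfolding sup_lipschitz_constant_def using ne by (intro cInf_greatest) auto
  assume x: "x \<in> S" "x' \<in> S"
  show "\<bar>g x - g x'\<bar> \<le> sup_lipschitz_constant S g * infnorm (x - x')"
  proof (cases "infnorm (x - x') = 0")
    case True
    then show ?thesis by (auto simp: infnorm_eq_0 infnorm_0)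
  next
    case False
    then have pos: "infnorm (x - x') > 0" by (simp add: infnorm_pos_lt infnorm_eq_0)
    have "\<bar>g x - g x'\<bar> / infnorm (x - x') \<le> sup_lipschitz_constant S g"
      unfolding sup_lipschitz_constant_def using ne pos x
      by (intro cInf_greatest) (auto simp: pos_divide_le_eq)
    then show ?thesis using pos by (simp add: pos_divide_le_eq)
  qed
qed

lemma gradient_lipschitz_bound:
  fixes f :: "real ^ 'n::finite \<Rightarrow> real"
  assumes "real_polynomial_function f"
  shows "0 \<le> gradient_lipschitz f"
    and "x \<in> unit_cube \<Longrightarrow> x' \<in> unit_cube \<Longrightarrow>
      \<bar>partial_derivative f i x - partial_derivative f i x'\<bar>
        \<le> gradient_lipschitz f * infnorm (x - x')"
proof -
  obtain C where C: "0 \<le> C i" "\<forall>x\<in>unit_cube. \<forall>x'\<in>unit_cube.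
      \<bar>partial_derivative f i x - partial_derivative f i x'\<bar> \<le> C i * infnorm (x - x')" for i
    using real_polynomial_function_lipschitz_unit_cube
      [OF real_polynomial_function_partial_derivative[OF assms]] by metis
  have le: "sup_lipschitz_constant unit_cube (partial_derivative f i) \<le> gradient_lipschitz f" for i
    unfolding gradient_lipschitz_def by (intro Max_ge) auto
  show "0 \<le> gradient_lipschitz f"
    using sup_lipschitz_constant_bound(1)[OF C(1) C(2)] le order_trans by blast
  assume "x \<in> unit_cube" "x' \<in> unit_cube"
  then have "\<bar>partial_derivative f i x - partial_derivative f i x'\<bar>
      \<le> sup_lipschitz_constant unit_cube (partial_derivative f i) * infnorm (x - x')"
    by (rule sup_lipschitz_constant_bound(2)[OF C(1) C(2)])
  also have "\<dots> \<le> gradient_lipschitz f * infnorm (x - x')"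
    by (intro mult_right_mono le infnorm_pos_le)
  finally show "\<bar>partial_derivative f i x - partial_derivative f i x'\<bar>
      \<le> gradient_lipschitz f * infnorm (x - x')" .
qed

section \<open>Uniform points and the minimal gap\<close>

lemma block_partition_cover:
  assumes "block_partition I"
  obtains j where "i \<in> I j"
  using assms unfolding block_partition_def by blast

lemma uniform_points_block:
  assumes "x \<in> uniform_points I"
  obtains A where "A \<noteq> {}" "A \<subseteq> I j" "\<And>i. i \<in> I j \<Longrightarrow> x $ i = 1 / real (card A) * indicator A i"
proof -
  have "\<exists>A. A \<noteq> {} \<and> A \<subseteq> I j \<and> (\<forall>i\<in>I j. x $ i = 1 / real (card A) * indicator A i)"
    using assms by (simp add: uniform_points_def)
  then show ?thesis using that by metis
qed

lemma uniform_points_simplex: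
  assumes "x \<in> uniform_points I"
  shows "(\<Sum>i\<in>I j. x $ i) = 1" and "i \<in> I j \<Longrightarrow> 0 \<le> x $ i"
proof -
  obtain A where A: "A \<noteq> {}" "A \<subseteq> I j" "\<And>i. i \<in> I j \<Longrightarrow> x $ i = 1 / real (card A) * indicator A i"
    using uniform_points_block[OF assms] by blast
  have "(\<Sum>i\<in>I j. x $ i) = 1 / real (card A) * (\<Sum>i\<in>I j. indicator A i)"
    using A(3) by (simp add: sum_distrib_left)
  also have "(\<Sum>i\<in>I j. indicator A i) = real (card A)"
    using A(2) by (simp add: indicator_def sum.If_cases Int_absorb1)
  finally show "(\<Sum>i\<in>I j. x $ i) = 1" using A(1) by simp
  show "i \<in> I j \<Longrightarrow> 0 \<le> x $ i" using A(3) by simp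
qed

lemma uniform_points_subset_unit_cube:
  assumes "block_partition I"
  shows "uniform_points I \<subseteq> unit_cube"
proof
  fix x assume x: "x \<in> uniform_points I"
  have "0 \<le> x $ i \<and> x $ i \<le> 1" for i
  proof -
    obtain j where i: "i \<in> I j" using block_partition_cover[OF assms] .
    have "x $ i \<le> (\<Sum>k\<in>I j. x $ k)"
      using i uniform_points_simplex(2)[OF x] by (intro member_le_sum) auto
    then show ?thesis using uniform_points_simplex[OF x] i by simp
  qed
  then show "x \<in> unit_cube" by (simp add: unit_cube_def)
qed

lemma finite_uniform_points:
  fixes I :: "'m::finite \<Rightarrow> 'n::finite set"
  assumes "block_partition I"
  shows "finite (uniform_points I)"
proof -
  define S where "S = range (\<lambda>A :: 'n set. 1 / real (card A)) \<union> {0}"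
  have "x $ i \<in> S" if x: "x \<in> uniform_points I" for x i
  proof -
    obtain j where i: "i \<in> I j" using block_partition_cover[OF assms] .
    obtain A where "\<And>i. i \<in> I j \<Longrightarrow> x $ i = 1 / real (card A) * indicator A i"
      using uniform_points_block[OF x] by blast
    with i have "x $ i = 1 / real (card A) * indicator A i" by simp
    then show ?thesis by (auto simp: S_def indicator_def)
  qed
  then have "uniform_points I \<subseteq> vec_lambda ` (PiE UNIV (\<lambda>_. S))"
    by (auto intro!: image_eqI[where x = "vec_nth _"])
  moreover have "finite (PiE (UNIV :: 'n set) (\<lambda>_. S))"
    by (intro finite_PiE) (auto simp: S_def)
  ultimately show ?thesis by (meson finite_imageI finite_subset)
qed

lemma finite_gap_values:
  assumes "block_partition I"
  shows "finite (gap_values I f)"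
proof (rule finite_subset)
  show "gap_values I f \<subseteq> (\<lambda>(x, i', i). \<bar>partial_derivative f i' x - partial_derivative f i x\<bar>)
          ` (uniform_points I \<times> UNIV \<times> UNIV)"
  proof
    fix v assume "v \<in> gap_values I f"
    then obtain x i' i where "x \<in> uniform_points I"
      "v = \<bar>partial_derivative f i' x - partial_derivative f i x\<bar>"
      unfolding gap_values_def by blast
    then show "v \<in> (\<lambda>(x, i', i). \<bar>partial_derivative f i' x - partial_derivative f i x\<bar>)
          ` (uniform_points I \<times> UNIV \<times> UNIV)"
      by (intro image_eqI[of _ _ "(x, i', i)"]) auto
  qed
qed (intro finite_imageI finite_cartesian_product
    finite_uniform_points[OF assms] finite_class.finite_UNIV)

lemma eq_if_below_minimal_gap:
  assumes "block_partition I" "x \<in> uniform_points I" "i \<in> I j" "i' \<in> I j"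
    and "\<bar>partial_derivative f i' x - partial_derivative f i x\<bar> \<le> c"
    and "ereal c < minimal_gap I f"
  shows "partial_derivative f i' x = partial_derivative f i x"
proof (rule ccontr)
  let ?v = "\<bar>partial_derivative f i' x - partial_derivative f i x\<bar>"
  assume "partial_derivative f i' x \<noteq> partial_derivative f i x"
  with assms(2-4) have v: "?v \<in> gap_values I f" unfolding gap_values_def by blast
  then have "minimal_gap I f \<le> ereal ?v"
    using Min_le[OF finite_gap_values[OF assms(1)] v] by (auto simp: minimal_gap_def)
  also have "\<dots> \<le> ereal c" using assms(5) by simp
  finally show False using assms(6) by simp
qed

section \<open>Equilibria of the softmax system\<close>

lemma equilibrium_eq_softmax:
  assumes "equilibrium I f T y" "i \<in> I j"
  shows "y $ i = softmax (I j) (\<lambda>k. - partial_derivative f k y) (1 / T) i"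
proof -
  have "softmax_field I f T y j i = 0" using assms unfolding equilibrium_def by blast
  then show ?thesis by (simp add: softmax_field_def)
qed

lemma softmax_pos_le_1:
  assumes "finite A" "i \<in> A"
  shows "0 < softmax A z \<beta> i" and "softmax A z \<beta> i \<le> 1"
proof -
  have le: "exp (\<beta> * z i) \<le> (\<Sum>k\<in>A. exp (\<beta> * z k))"
    using assms by (intro member_le_sum) auto
  then have "0 < (\<Sum>k\<in>A. exp (\<beta> * z k))" by (rule less_le_trans[OF exp_gt_zero])
  with le show "0 < softmax A z \<beta> i" "softmax A z \<beta> i \<le> 1" by (simp_all add: softmax_def)
qed

lemma equilibrium_in_unit_cube:
  assumes "block_partition I" "equilibrium I f T y"
  shows "y \<in> unit_cube"
proof -
  have "0 \<le> y $ i \<and> y $ i \<le> 1" for i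
  proof -
    obtain j where i: "i \<in> I j" using block_partition_cover[OF assms(1)] .
    show ?thesis
      unfolding equilibrium_eq_softmax[OF assms(2) i]
      by (simp add: softmax_pos_le_1 less_imp_le i)
  qed
  then show ?thesis by (simp add: unit_cube_def)
qed

text \<open>The normalising sum cancels from the ratio of two softmax entries.\<close>

lemma equilibrium_gradient_difference:
  assumes "equilibrium I f T y" "T > 0" "i \<in> I j" "k \<in> I j"
  shows "T * ln (y $ i / y $ k) = partial_derivative f k y - partial_derivative f i y"
proof -
  let ?z = "\<lambda>k. - partial_derivative f k y"
  have "(\<Sum>l\<in>I j. exp (1 / T * ?z l)) > 0" using assms(3) by (intro sum_pos) auto
  then have "y $ i / y $ k = exp (1 / T * ?z i) / exp (1 / T * ?z k)"
    using equilibrium_eq_softmax[OF assms(1,3)] equilibrium_eq_softmax[OF assms(1,4)]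
    by (simp add: softmax_def)
  also have "\<dots> = exp ((partial_derivative f k y - partial_derivative f i y) / T)"
    by (simp add: exp_diff[symmetric] diff_divide_distrib)
  finally show ?thesis using assms(2) by simp
qed

section \<open>Hard max and local optimality\<close>

lemma hardmax_eq_uniform:
  assumes "finite B" "A \<noteq> {}" "A \<subseteq> B" "i \<in> B"
    and eq: "\<And>a a'. a \<in> A \<Longrightarrow> a' \<in> A \<Longrightarrow> z a = z a'"
    and less: "\<And>a k. a \<in> A \<Longrightarrow> k \<in> B - A \<Longrightarrow> z k < z a"
  shows "hardmax B z i = 1 / real (card A) * indicator A i"
proof -
  obtain a where a: "a \<in> A" using assms(2) by blast
  have "Max (z ` B) = z a"
  proof (rule Max_eqI)
    fix y assume "y \<in> z ` B"
    then obtain k where k: "k \<in> B" "y = z k" by blast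
    show "y \<le> z a"
    proof (cases "k \<in> A")
      case True
      then show ?thesis using eq[OF True a] k by simp
    next
      case False
      then show ?thesis using less[OF a, of k] k by simp
    qed
  next
    show "z a \<in> z ` B" using a assms(3) by blast
  qed (simp add: assms(1))
  moreover have "z k = z a \<longleftrightarrow> k \<in> A" if "k \<in> B" for k
    using eq[OF _ a, of k] less[OF a, of k] that by (cases "k \<in> A") auto
  ultimately have iff: "z k = Max (z ` B) \<longleftrightarrow> k \<in> A" if "k \<in> B" for k
    using that by simp
  then have "{k \<in> B. z k = Max (z ` B)} = A" using assms(3) by auto
  then show ?thesis using iff[OF assms(4)] by (simp add: hardmax_def indicator_def)
qed

lemma weighted_average_le_hardmax:
  fixes p :: "'i \<Rightarrow> real"
  assumes "finite B" "(\<Sum>i\<in>B. p i) = 1" "\<And>i. i \<in> B \<Longrightarrow> 0 \<le> p i"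
    and "(\<Sum>i\<in>B. hardmax B z i) = 1"
  shows "(\<Sum>i\<in>B. z i * p i) \<le> (\<Sum>i\<in>B. z i * hardmax B z i)"
proof -
  let ?M = "Max (z ` B)"
  have "(\<Sum>i\<in>B. z i * p i) \<le> (\<Sum>i\<in>B. ?M * p i)"
    using assms(1,3) by (intro sum_mono mult_right_mono) auto
  also have "\<dots> = (\<Sum>i\<in>B. ?M * hardmax B z i)"
    using assms(2,4) by (simp flip: sum_distrib_left)
  also have "\<dots> = (\<Sum>i\<in>B. z i * hardmax B z i)"
    by (intro sum.cong) (auto simp: hardmax_def)
  finally show ?thesis .
qed

lemma affine_in_block_difference:
  fixes f :: "real ^ 'n::finite \<Rightarrow> real"
  assumes "affine_in_block B f" "\<And>i. i \<notin> B \<Longrightarrow> x' $ i = x $ i"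
  shows "f x' - f x = (\<Sum>i\<in>B. partial_derivative f i x * (x' $ i - x $ i))"
proof -
  obtain a c where ac: "\<And>\<xi>. f (replace_block B x \<xi>) = (\<Sum>i\<in>B. a i * \<xi> $ i) + c"
    using assms(1) unfolding affine_in_block_def by blast
  have f: "f w = (\<Sum>i\<in>B. a i * w $ i) + c" if "\<And>i. i \<notin> B \<Longrightarrow> w $ i = x $ i" for w
  proof -
    have "replace_block B x w = w" using that by (simp add: replace_block_def vec_eq_iff)
    then show ?thesis using ac[of w] by simp
  qed
  have pd: "partial_derivative f i x = a i" if i: "i \<in> B" for i
  proof -
    have "f (x + t *\<^sub>R axis i 1) = f x + a i * t" for t
    proof -
      have "f (x + t *\<^sub>R axis i 1) = (\<Sum>k\<in>B. a k * (x + t *\<^sub>R axis i 1) $ k) + c"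
        using i by (intro f) (auto simp: axis_def)
      also have "(\<Sum>k\<in>B. a k * (x + t *\<^sub>R axis i 1) $ k)
          = (\<Sum>k\<in>B. a k * x $ k) + (\<Sum>k\<in>B. if k = i then a i * t else 0)"
        unfolding sum.distrib[symmetric] by (intro sum.cong) (auto simp: axis_def algebra_simps)
      finally show ?thesis using f[of x] i by simp
    qed
    moreover have "((\<lambda>t. f x + a i * t) has_real_derivative a i) (at 0)"
      by (auto intro!: derivative_eq_intros)
    ultimately show ?thesis
      unfolding partial_derivative_def by (simp add: DERIV_imp_deriv)
  qed
  have "f x' - f x = (\<Sum>i\<in>B. a i * (x' $ i - x $ i))"
    using f[OF assms(2)] f[of x] by (simp add: right_diff_distrib sum_subtractf)
  then show ?thesis using pd by simp
qed

text \<open>Changing one block alters \<open>f\<close> by the change of the gradient-weighted average over that block,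
  which the hard max makes as small as possible.\<close>

lemma local_optimum_if_hardmax:
  assumes "\<And>j. affine_in_block (I j) f" "x \<in> uniform_points I"
    and hm: "\<And>j i. i \<in> I j \<Longrightarrow> x $ i = hardmax (I j) (\<lambda>k. - partial_derivative f k x) i"
  shows "local_optimum I f x"
  unfolding local_optimum_def
proof (intro conjI ballI impI)
  fix x' assume x': "x' \<in> uniform_points I" and "\<exists>j. \<forall>i. i \<notin> I j \<longrightarrow> x' $ i = x $ i"
  then obtain j where j: "\<And>i. i \<notin> I j \<Longrightarrow> x' $ i = x $ i" by blast
  let ?z = "\<lambda>k. - partial_derivative f k x"
  have "(\<Sum>i\<in>I j. ?z i * x' $ i) \<le> (\<Sum>i\<in>I j. ?z i * hardmax (I j) ?z i)"
    using uniform_points_simplex[OF x', where j = j] uniform_points_simplex(1)[OF assms(2), of j] hm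
    by (intro weighted_average_le_hardmax) simp_all
  also have "\<dots> = (\<Sum>i\<in>I j. ?z i * x $ i)" using hm by simp
  finally have "0 \<le> (\<Sum>i\<in>I j. partial_derivative f i x * (x' $ i - x $ i))"
    by (simp add: right_diff_distrib sum_subtractf sum_negf)
  then show "f x \<le> f x'"
    using affine_in_block_difference[of "I j" f x' x, OF assms(1) j] by simp
qed (rule assms(2))

section \<open>Uniform points near an equilibrium\<close>

text \<open>Here \<open>r\<close> stands for the size of the support of a block and \<open>u\<close>, \<open>v\<close> for equilibrium entries.
  The error relative to the value \<open>1 / r\<close> is \<open>r * \<epsilon>\<close>, so both bounds are worst when the support has
  the largest size \<open>d\<close>; this is how they become uniform in \<open>r\<close>.\<close>

lemma ratio_bound_on_support:
  fixes \<epsilon> d r u v :: real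
  assumes "0 < r" "r \<le> d" "0 < \<epsilon>" "d * \<epsilon> < 1"
    and "\<bar>1 / r - u\<bar> \<le> \<epsilon>" "\<bar>1 / r - v\<bar> \<le> \<epsilon>"
  shows "u / v \<le> (1 + d * \<epsilon>) / (1 - d * \<epsilon>)"
proof -
  have rd: "r * \<epsilon> \<le> d * \<epsilon>" using assms(2,3) by simp
  have u: "u * r \<le> 1 + d * \<epsilon>"
  proof -
    have "u * r \<le> (1 / r + \<epsilon>) * r" using assms by (intro mult_right_mono) auto
    also have "\<dots> = 1 + r * \<epsilon>" using assms(1) by (simp add: field_simps)
    finally show ?thesis using rd by simp
  qed
  have v: "1 - d * \<epsilon> \<le> v * r"
  proof -
    have "1 - r * \<epsilon> = (1 / r - \<epsilon>) * r" using assms(1) by (simp add: field_simps)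
    also have "\<dots> \<le> v * r" using assms by (intro mult_right_mono) auto
    finally show ?thesis using rd by simp
  qed
  have "u / v = (u * r) / (v * r)" using assms(1) by simp
  also have "\<dots> \<le> (1 + d * \<epsilon>) / (1 - d * \<epsilon>)"
    using u v assms by (intro frac_le) (auto intro: add_nonneg_nonneg)
  finally show ?thesis .
qed

lemma ratio_bound_off_support:
  fixes \<epsilon> d r u v :: real
  assumes "0 < r" "r \<le> d" "0 < \<epsilon>" "d * \<epsilon> < 1" "0 < v" "v \<le> \<epsilon>" "\<bar>1 / r - u\<bar> \<le> \<epsilon>"
  shows "1 / (d * \<epsilon>) - 1 \<le> u / v"
proof -
  have dr: "1 / d \<le> 1 / r" using assms by (intro divide_left_mono) auto
  then have du: "1 / d - \<epsilon> \<le> u" using assms(7) by linarith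
  have pos: "0 \<le> 1 / d - \<epsilon>" using assms by (simp add: field_simps)
  have "1 / (d * \<epsilon>) - 1 = (1 / d - \<epsilon>) / \<epsilon>" using assms by (simp add: field_simps)
  also have "\<dots> \<le> u / v" using du pos assms by (intro frac_le) auto
  finally show ?thesis .
qed

theorem proposition3p3:
  fixes I :: "'m::finite \<Rightarrow> 'n::finite set"
    and f :: "real ^ 'n \<Rightarrow> real"
    and ybar yhat :: "real ^ 'n"
    and T \<epsilon> :: real
  assumes "block_partition I"
    and "real_polynomial_function f"
    and "\<And>j. affine_in_block (I j) f"
    and "T > 0"
    and "equilibrium I f T ybar"
    and "yhat \<in> uniform_points I"
    and "\<epsilon> = infnorm (yhat - ybar)"
    and "\<epsilon> > 0"
    and "real (max_block_size I) * \<epsilon> < 1 / 2"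
    and "ereal (\<epsilon> / ln (1 / (real (max_block_size I) * \<epsilon>) - 1))
         < (if gradient_lipschitz f = 0 then \<infinity> else ereal (T / (2 * gradient_lipschitz f)))"
    and "ereal (T * ln ((1 + real (max_block_size I) * \<epsilon>) / (1 - real (max_block_size I) * \<epsilon>))
           + 2 * gradient_lipschitz f * \<epsilon>)
         < minimal_gap I f"
  shows "(\<forall>j. \<forall>i\<in>I j. yhat $ i = hardmax (I j) (\<lambda>k. - partial_derivative f k yhat) i)
         \<and> local_optimum I f yhat"
proof -
  note part = assms(1) and poly = assms(2) and T = assms(4) and equil = assms(5)
    and unif = assms(6) and eps = assms(8)
  define d where "d = real (max_block_size I)"
  define L where "L = gradient_lipschitz f"
  let ?\<Phi> = "partial_derivative f"
  have card_le: "real (card A) \<le> d" if "A \<subseteq> I j" for A j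
  proof -
    have "card A \<le> card (I j)" using that by (intro card_mono) auto
    also have "\<dots> \<le> max_block_size I" unfolding max_block_size_def by (intro Max_ge) auto
    finally show ?thesis by (simp add: d_def)
  qed
  have d0: "d > 0"
  proof -
    have "card (I undefined) \<ge> 2" using part by (simp add: block_partition_def)
    then show ?thesis using card_le[of "I undefined" undefined] by simp
  qed
  have de: "d * \<epsilon> < 1 / 2" using assms(9) by (simp add: d_def)
  have close: "\<bar>yhat $ i - ybar $ i\<bar> \<le> \<epsilon>" for i
    using component_le_infnorm_cart[of "yhat - ybar" i] assms(7) by simp
  have L0: "L \<ge> 0" unfolding L_def by (rule gradient_lipschitz_bound(1)[OF poly])
  have lip: "\<bar>?\<Phi> i yhat - ?\<Phi> i ybar\<bar> \<le> L * \<epsilon>" for i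
    unfolding L_def assms(7)
    using uniform_points_subset_unit_cube[OF part] unif equilibrium_in_unit_cube[OF part equil]
    by (intro gradient_lipschitz_bound(2)[OF poly]) auto
  have ln_pos: "ln (1 / (d * \<epsilon>) - 1) > 0"
  proof -
    have "2 < 1 / (d * \<epsilon>)" using de d0 eps by (simp add: field_simps)
    then show ?thesis by (intro ln_gt_zero) simp
  qed
  have step: "2 * L * \<epsilon> < T * ln (1 / (d * \<epsilon>) - 1)"
  proof (cases "L = 0")
    case True
    then show ?thesis using T ln_pos by simp
  next
    case False
    then have "\<epsilon> / ln (1 / (d * \<epsilon>) - 1) < T / (2 * L)"
      using assms(10) by (simp add: L_def d_def)
    then show ?thesis using ln_pos L0 False by (simp add: field_simps)
  qed
  have hm: "yhat $ i = hardmax (I j) (\<lambda>k. - ?\<Phi> k yhat) i" if ij: "i \<in> I j" for i j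
  proof -
    obtain A where A: "A \<noteq> {}" "A \<subseteq> I j"
      and yA: "\<And>i. i \<in> I j \<Longrightarrow> yhat $ i = 1 / real (card A) * indicator A i"
      using uniform_points_block[OF unif] by blast
    define r where "r = real (card A)"
    have r: "0 < r" "r \<le> d"
      using A(1) card_le[OF A(2)] by (auto simp: r_def card_gt_0_iff)
    have on: "\<bar>1 / r - ybar $ a\<bar> \<le> \<epsilon>" if "a \<in> A" for a
      using close[of a] yA[of a] that A(2) by (auto simp: r_def)
    have pos: "ybar $ k > 0" if "k \<in> I j" for k
      unfolding equilibrium_eq_softmax[OF equil that] using that by (simp add: softmax_pos_le_1)
    have diff: "T * ln (ybar $ i / ybar $ k) = ?\<Phi> k ybar - ?\<Phi> i ybar" if "i \<in> I j" "k \<in> I j" for i k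
      by (rule equilibrium_gradient_difference[OF equil T that])
    define c where "c = T * ln ((1 + d * \<epsilon>) / (1 - d * \<epsilon>)) + 2 * L * \<epsilon>"
    have le_c: "?\<Phi> k yhat - ?\<Phi> a yhat \<le> c" if "a \<in> A" "k \<in> A" for a k
    proof -
      have I: "a \<in> I j" "k \<in> I j" using that A(2) by auto
      have "ybar $ a / ybar $ k \<le> (1 + d * \<epsilon>) / (1 - d * \<epsilon>)"
        using r eps de on that by (intro ratio_bound_on_support) auto
      then have "ln (ybar $ a / ybar $ k) \<le> ln ((1 + d * \<epsilon>) / (1 - d * \<epsilon>))"
        using pos I by (intro ln_mono) auto
      then have "?\<Phi> k ybar - ?\<Phi> a ybar \<le> T * ln ((1 + d * \<epsilon>) / (1 - d * \<epsilon>))"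
        using T by (simp add: diff[OF I, symmetric])
      then show ?thesis using lip[of a] lip[of k] by (simp add: c_def abs_le_iff)
    qed
    have eq: "?\<Phi> k yhat = ?\<Phi> a yhat" if "a \<in> A" "k \<in> A" for a k
    proof (rule eq_if_below_minimal_gap[OF part unif])
      show "\<bar>?\<Phi> k yhat - ?\<Phi> a yhat\<bar> \<le> c"
        using le_c[OF that] le_c[OF that(2,1)] by linarith
      show "ereal c < minimal_gap I f" using assms(11) by (simp add: c_def d_def L_def)
    qed (use that A(2) in auto)
    have less: "?\<Phi> a yhat < ?\<Phi> k yhat" if "a \<in> A" "k \<in> I j - A" for a k
    proof -
      have I: "a \<in> I j" "k \<in> I j" using that A(2) by auto
      have "ybar $ k \<le> \<epsilon>" using close[of k] yA[OF I(2)] that(2) by simp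
      then have "1 / (d * \<epsilon>) - 1 \<le> ybar $ a / ybar $ k"
        using r eps de on[OF that(1)] pos[OF I(2)] by (intro ratio_bound_off_support) auto
      moreover have "0 < 1 / (d * \<epsilon>) - 1" using de d0 eps by (simp add: field_simps)
      ultimately have "ln (1 / (d * \<epsilon>) - 1) \<le> ln (ybar $ a / ybar $ k)"
        by (intro ln_mono) auto
      then have "T * ln (1 / (d * \<epsilon>) - 1) \<le> ?\<Phi> k ybar - ?\<Phi> a ybar"
        using T by (simp add: diff[OF I, symmetric])
      then show ?thesis using step lip[of a] lip[of k] by (simp add: abs_le_iff)
    qed
    have "hardmax (I j) (\<lambda>k. - ?\<Phi> k yhat) i = 1 / real (card A) * indicator A i"
    proof (rule hardmax_eq_uniform[OF _ A ij])
      show "- ?\<Phi> a yhat = - ?\<Phi> a' yhat" if "a \<in> A" "a' \<in> A" for a a'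
        using eq[OF that] by simp
      show "- ?\<Phi> k yhat < - ?\<Phi> a yhat" if "a \<in> A" "k \<in> I j - A" for a k
        using less[OF that] by simp
    qed simp
    then show ?thesis using yA[OF ij] by simp
  qed
  moreover have "local_optimum I f yhat"
    using assms(3) unif hm by (rule local_optimum_if_hardmax)
  ultimately show ?thesis by blast
qed

end
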